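(* Let $r$ be an odd integer and let $n$ be a positive integer. Then \[ L_{3r}\sum_{k=1}^n L_{2rk}^3= \begin{cases} 5F_{rn}F_{rn+r}\left(L_{rn}L_{rn+r}L_{2rn+r}+4(L_{2r}+1)\right) & \text{if $n$ is even,}\\ L_{rn}L_{rn+r}\left(5F_{rn}F_{rn+r}L_{2rn+r}+4(L_{2r}+1)\right) & \text{if $n$ is odd.} \end{cases} \]
   Context: The Fibonacci numbers $F_m$ and Lucas numbers $L_m$ are defined for all $m\in\mathbb{Z}$ by $F_m=F_{m-1}+F_{m-2}$, $F_0=0$, $F_1=1$, and $L_m=L_{m-1}+L_{m-2}$, $L_0=2$, $L_1=1$; in particular $F_{-m}=(-1)^{m-1}F_m$ and $L_{-m}=(-1)^mL_m$. *)

theory Defs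
  imports "HOL-Number_Theory.Fib"
begin

fun lucas_nat :: "nat \<Rightarrow> int" where
  "lucas_nat 0 = 2"
| "lucas_nat (Suc 0) = 1"
| "lucas_nat (Suc (Suc n)) = lucas_nat (Suc n) + lucas_nat n"

text \<open>
  The integer-indexed sequences are the library's \<^const>\<open>fib\<close> and \<^const>\<open>lucas_nat\<close>, continued
  to negative indices by the reflection formulas. The lemmas below show that the two-sided
  recurrences hold at every integer index; together with the initial values
  they determine both sequences.
\<close>

definition Fibonacci :: "int \<Rightarrow> int" where
  "Fibonacci m = (if m \<ge> 0 then int (fib (nat m))
     else (- 1) ^ (nat (- m) + 1) * int (fib (nat (- m))))"

definition Lucas :: "int \<Rightarrow> int" where
  "Lucas m = (if m \<ge> 0 then lucas_nat (nat m)
     else (- 1) ^ nat (- m) * lucas_nat (nat (- m)))"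

lemma Fibonacci_0: "Fibonacci 0 = 0" and Fibonacci_1: "Fibonacci 1 = 1"
  by (simp_all add: Fibonacci_def)

lemma Lucas_0: "Lucas 0 = 2" and Lucas_1: "Lucas 1 = 1"
  by (simp_all add: Lucas_def)

lemma int_index_cases:
  fixes m :: int
  obtains (ge) j where "m = int j + 2" | (one) "m = 1" | (le) j where "m = - int j"
proof (cases "m \<ge> 2")
  case True
  then show thesis using ge[of "nat (m - 2)"] by simp
next
  case False
  then show thesis using one le[of "nat (- m)"] by (cases "m = 1") auto
qed

lemma Fibonacci_rec: "Fibonacci m = Fibonacci (m - 1) + Fibonacci (m - 2)"
proof (cases m rule: int_index_cases)
  case (ge j)
  have "nat (int j + 2) = Suc (Suc j)" "nat (1 + int j) = Suc j" by auto
  with ge show ?thesis by (simp add: Fibonacci_def)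
next
  case one
  then show ?thesis by (simp add: Fibonacci_def)
next
  case (le j)
  have "nat (1 + int j) = Suc j" "nat (2 + int j) = Suc (Suc j)" by auto
  with le show ?thesis by (cases "j = 0") (auto simp: Fibonacci_def algebra_simps)
qed

lemma Lucas_rec: "Lucas m = Lucas (m - 1) + Lucas (m - 2)"
proof (cases m rule: int_index_cases)
  case (ge j)
  have "nat (int j + 2) = Suc (Suc j)" "nat (1 + int j) = Suc j" by auto
  with ge show ?thesis by (simp add: Lucas_def)
next
  case one
  then show ?thesis by (simp add: Lucas_def)
next
  case (le j)
  have "nat (1 + int j) = Suc j" "nat (2 + int j) = Suc (Suc j)" by auto
  with le show ?thesis by (cases "j = 0") (auto simp: Lucas_def algebra_simps numeral_2_eq_2)
qed

end

theory Submission
  imports Defs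
begin

text \<open>
  Put $X_n = L_{2rn+r}$ and $a = L_r$. The product formulas for $L_b L_c$ and $5 F_b F_c$
  turn the two products $5 F_{rn} F_{rn+r}$ and $L_{rn} L_{rn+r}$ into $X_n - a$ and
  $X_n + a$; which is which depends on the parity of $rn$, hence on that of $n$. The
  distinction of cases in the theorem compensates exactly for this, so in both cases the
  right-hand side is $g(X_n)$ for
  \[ g(X) = (X - a) \, (X (X + a) + 4 (L_{2r} + 1)). \]
  It remains to see that the sum telescopes, and $g(X_0) = g(a) = 0$ gives the start.
  With $m = 2rk$ one has $X_k - X_{k-1} = L_m a$ and $X_k X_{k-1} = L_m^2 - a^2 - 4$.
  As $L_{2r} = a^2 + 2$ gives
  $g(X) = X^3 + (3 a^2 + 12) X - 4 a (a^2 + 3)$, these two relations yield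
  $g(X_k) - g(X_{k-1}) = a (a^2 + 3) L_m^3 = L_{3r} L_m^3$.

  The product formulas hold because both sides, as functions of one index, satisfy the
  Fibonacci recurrence and agree at $0$ and $1$.
\<close>

text \<open>
  The recurrence can be run in both directions, so two consecutive values determine a
  two-sided sequence.
\<close>

lemma fibonacci_recurrence_unique:
  fixes f g :: "int \<Rightarrow> int"
  assumes f: "\<And>m. f m = f (m - 1) + f (m - 2)"
    and g: "\<And>m. g m = g (m - 1) + g (m - 2)"
    and "f 0 = g 0" "f 1 = g 1"
  shows "f m = g m"
proof -
  have "f m = g m \<and> f (m + 1) = g (m + 1)"
  proof (induction m rule: int_induct[where k = 0])
    case base
    then show ?case using assms(3,4) by simp
  next
    case (step1 i)
    then show ?case using f[of "i + 2"] g[of "i + 2"] by (simp add: add.commute)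
  next
    case (step2 i)
    then show ?case using f[of "i + 1"] g[of "i + 1"] by simp
  qed
  then show ?thesis ..
qed

lemma five_times_Fibonacci: "5 * Fibonacci m = Lucas (m + 1) + Lucas (m - 1)"
proof (rule fibonacci_recurrence_unique[of "\<lambda>m. 5 * Fibonacci m"])
  show "5 * Fibonacci m = 5 * Fibonacci (m - 1) + 5 * Fibonacci (m - 2)" for m
    using Fibonacci_rec[of m] by simp
  show "Lucas (m + 1) + Lucas (m - 1) =
      Lucas (m - 1 + 1) + Lucas (m - 1 - 1) + (Lucas (m - 2 + 1) + Lucas (m - 2 - 1))" for m
    using Lucas_rec[of "m + 1"] Lucas_rec[of "m - 1"] by simp
  show "5 * Fibonacci 0 = Lucas (0 + 1) + Lucas (0 - 1)"
    using Lucas_rec[of 1] by (simp add: Fibonacci_0 Lucas_0 Lucas_1)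
  show "5 * Fibonacci 1 = Lucas (1 + 1) + Lucas (1 - 1)"
    using Lucas_rec[of 2] by (simp add: Fibonacci_1 Lucas_0 Lucas_1)
qed

text \<open>
  The alternating sign is what makes the right-hand side satisfy the recurrence in \<open>b\<close>:
  reversing the direction of the index in \<^term>\<open>Lucas (a - b)\<close> changes the recurrence to
  $x_b = x_{b-2} - x_{b-1}$, and the sign repairs this.
\<close>

lemma Lucas_mult_Lucas:
  "Lucas a * Lucas b =
    (if even b then Lucas (a + b) + Lucas (a - b) else Lucas (a + b) - Lucas (a - b))"
proof (rule fibonacci_recurrence_unique[of "\<lambda>b. Lucas a * Lucas b"])
  show "Lucas a * Lucas b = Lucas a * Lucas (b - 1) + Lucas a * Lucas (b - 2)" for b
    using Lucas_rec[of b] by (simp add: distrib_left)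
  let ?G = "\<lambda>b. if even b then Lucas (a + b) + Lucas (a - b) else Lucas (a + b) - Lucas (a - b)"
  show "?G b = ?G (b - 1) + ?G (b - 2)" for b
    using Lucas_rec[of "a + b"] Lucas_rec[of "a - b + 2"] by (simp add: algebra_simps)
  show "Lucas a * Lucas 0 = ?G 0"
    by (simp add: Lucas_0)
  show "Lucas a * Lucas 1 = ?G 1"
    using Lucas_rec[of "a + 1"] by (simp add: Lucas_1)
qed

lemma five_times_Fibonacci_mult_Fibonacci:
  "5 * Fibonacci a * Fibonacci b =
    (if even b then Lucas (a + b) - Lucas (a - b) else Lucas (a + b) + Lucas (a - b))"
proof (rule fibonacci_recurrence_unique[of "\<lambda>b. 5 * Fibonacci a * Fibonacci b"])
  show "5 * Fibonacci a * Fibonacci b =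
      5 * Fibonacci a * Fibonacci (b - 1) + 5 * Fibonacci a * Fibonacci (b - 2)" for b
    using Fibonacci_rec[of b] by (simp add: distrib_left)
  let ?G = "\<lambda>b. if even b then Lucas (a + b) - Lucas (a - b) else Lucas (a + b) + Lucas (a - b)"
  show "?G b = ?G (b - 1) + ?G (b - 2)" for b
    using Lucas_rec[of "a + b"] Lucas_rec[of "a - b + 2"] by (simp add: algebra_simps)
  show "5 * Fibonacci a * Fibonacci 0 = ?G 0"
    by (simp add: Fibonacci_0)
  show "5 * Fibonacci a * Fibonacci 1 = ?G 1"
    using five_times_Fibonacci[of a] by (simp add: Fibonacci_1)
qed

lemma Lucas_double:
  "Lucas (2 * m) = (if even m then Lucas m ^ 2 - 2 else Lucas m ^ 2 + 2)"
  using Lucas_mult_Lucas[of m m] by (simp add: Lucas_0 power2_eq_square split: if_splits)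

lemma Lucas_triple_odd:
  assumes "odd r"
  shows "Lucas (3 * r) = Lucas r * (Lucas r ^ 2 + 3)"
proof -
  have "Lucas (2 * r) * Lucas r = Lucas (3 * r) - Lucas r"
    using Lucas_mult_Lucas[of "2 * r" r] assms by simp
  moreover have "Lucas (2 * r) = Lucas r ^ 2 + 2"
    using assms by (simp add: Lucas_double)
  ultimately show ?thesis
    by (simp add: algebra_simps)
qed

text \<open>
  The difference $g(x) - g(y)$ of the top comment, at $x = L_{m+r}$ and $y = L_{m-r}$. It
  factors as $(x - y) \, (x^2 + xy + y^2 + 3 a^2 + 12)$, and since
  $x^2 + xy + y^2 = (x - y)^2 + 3xy$, only $x - y$ and $xy$ need to be known.
\<close>

lemma Lucas_cube_telescope:
  assumes "odd r" "even m"
  defines "g \<equiv> \<lambda>x. (x - Lucas r) * (x * (x + Lucas r) + 4 * (Lucas (2 * r) + 1))"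
  shows "Lucas (3 * r) * Lucas m ^ 3 = g (Lucas (m + r)) - g (Lucas (m - r))"
proof -
  define a where "a = Lucas r"
  define x where "x = Lucas (m + r)"
  define y where "y = Lucas (m - r)"
  have diff: "x - y = Lucas m * a"
    using Lucas_mult_Lucas[of m r] assms(1) by (simp add: x_def y_def a_def)
  have prod: "x * y = Lucas m ^ 2 - a ^ 2 - 4"
    using Lucas_mult_Lucas[of "m + r" "m - r"] Lucas_double[of m] Lucas_double[of r] assms(1,2)
    by (simp add: x_def y_def a_def algebra_simps)
  have L2r: "Lucas (2 * r) = a ^ 2 + 2"
    using assms(1) by (simp add: Lucas_double a_def)
  have "g x - g y = (x - y) * ((x - y) ^ 2 + 3 * (x * y) + 3 * a ^ 2 + 12)"
    unfolding g_def a_def[symmetric] L2r by (simp add: algebra_simps power2_eq_square)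
  also have "\<dots> = Lucas m * a * (Lucas m ^ 2 * (a ^ 2 + 3))"
    unfolding diff prod by (simp add: algebra_simps power2_eq_square)
  also have "\<dots> = Lucas (3 * r) * Lucas m ^ 3"
    using assms(1) by (simp add: Lucas_triple_odd a_def power2_eq_square power3_eq_cube)
  finally show ?thesis
    unfolding x_def y_def by simp
qed

lemma sum_Lucas_cubes:
  assumes "odd r"
  shows "Lucas (3 * r) * (\<Sum>k=1..n. Lucas (2 * r * int k) ^ 3) =
    (Lucas (2 * r * int n + r) - Lucas r) *
      (Lucas (2 * r * int n + r) * (Lucas (2 * r * int n + r) + Lucas r)
        + 4 * (Lucas (2 * r) + 1))"
proof (induction n)
  case 0
  then show ?case by simp
next
  case (Suc n)
  have shift: "2 * r * int (Suc n) - r = 2 * r * int n + r"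
    by (simp add: algebra_simps)
  show ?case
    using Suc.IH Lucas_cube_telescope[of r "2 * r * int (Suc n)", unfolded shift] assms
    by (simp add: distrib_left del: of_nat_Suc)
qed

theorem theorem3p5:
  fixes r :: int and n :: nat
  assumes "odd r" and "n > 0"
  shows "Lucas (3 * r) * (\<Sum>k=1..n. Lucas (2 * r * int k) ^ 3) =
    (if even n then
       5 * Fibonacci (r * int n) * Fibonacci (r * int n + r) *
         (Lucas (r * int n) * Lucas (r * int n + r) * Lucas (2 * r * int n + r)
            + 4 * (Lucas (2 * r) + 1))
     else
       Lucas (r * int n) * Lucas (r * int n + r) *
         (5 * Fibonacci (r * int n) * Fibonacci (r * int n + r) * Lucas (2 * r * int n + r)
            + 4 * (Lucas (2 * r) + 1)))"
proof -
  let ?X = "Lucas (2 * r * int n + r)"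
  have idx: "(r * int n + r) + r * int n = 2 * r * int n + r"
    by (simp add: algebra_simps)
  have FF: "5 * Fibonacci (r * int n) * Fibonacci (r * int n + r) =
      (if even n then ?X - Lucas r else ?X + Lucas r)"
    using five_times_Fibonacci_mult_Fibonacci[of "r * int n + r" "r * int n", unfolded idx]
      \<open>odd r\<close> by (simp add: mult.commute mult.left_commute)
  have LL: "Lucas (r * int n) * Lucas (r * int n + r) =
      (if even n then ?X + Lucas r else ?X - Lucas r)"
    using Lucas_mult_Lucas[of "r * int n + r" "r * int n", unfolded idx] \<open>odd r\<close>
    by (simp add: mult.commute)
  show ?thesis
    unfolding sum_Lucas_cubes[OF \<open>odd r\<close>] FF LL by (simp add: mult.commute)
qed

end
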